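(* There exists an absolute constant $c>0$ such that the following holds. For every stream length $n$ and every integer $N$ with $n^{6\ln n}\le N\le 2^{n/2}$, there is a set system $(U,\mathcal{R})$ of VC-dimension $1$ with $|U|=|\mathcal{R}|=N$ such that for all $0<\varepsilon,\delta<1/2$: (1) $\mathsf{BernoulliSample}$ with parameter $p < c\cdot\frac{\ln|\mathcal{R}|}{n\ln n}$ is not $(\varepsilon,\delta)$-robust with respect to $(U,\mathcal{R})$ and $n$; (2) $\mathsf{ReservoirSample}$ with parameter $k < c\cdot\frac{\ln|\mathcal{R}|}{\ln n}$ is not $(\varepsilon,\delta)$-robust with respect to $(U,\mathcal{R})$ and $n$.
   Context: A set system is a pair $(U,\mathcal{R})$ with $\mathcal{R}\subseteq 2^U$. For a finite sequence $X=(x_1,\dots,x_m)$ of elements of $U$ (repetitions allowed) and $R\subseteq U$, the density is $d_R(X) = |\{i\in[m] : x_i\in R\}|/m$. A non-empty subsequence $S$ of $X$ is an $\varepsilon$-approximation of $X$ with respect to $(U,\mathcal{R})$ if $|d_R(X)-d_R(S)|\le\varepsilon$ for every $R\in\mathcal{R}$. Adaptive game: for rounds $i=1,\dots,n$, an adversary (computationally unbounded, possibly randomized, with a strategy fixed in advance) chooses $x_i\in U$ as a function of $x_1,\dots,x_{i-1}$ and the sampler's current state $\sigma_{i-1}$; then the sampler updates its state $\sigma_i$ from $\sigma_{i-1}$ and $x_i$; the adversary observes $\sigma_i$. The sample is $S=\sigma_n$, a subsequence of $X=(x_1,\dots,x_n)$. A sampler is $(\varepsilon,\delta)$-robust with respect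 to $(U,\mathcal{R})$ and $n$ if for every adversary strategy, with probability at least $1-\delta$ the sample $S$ is an $\varepsilon$-approximation of $X$ with respect to $(U,\mathcal{R})$. $\mathsf{BernoulliSample}$ with parameter $p\in[0,1]$: each arriving element is independently added to the sample with probability $p$ (the state is the current sample). $\mathsf{ReservoirSample}$ with parameter $k$: the first $k$ elements are stored; when the $i$-th element arrives with $i>k$, with probability $k/i$ it replaces a uniformly random one of the $k$ stored elements, and otherwise the sample is unchanged (the state is the current sample). *)

theory Defs
  imports "HOL-Probability.Probability" "HOL-Library.Extended_Nat" "HOL-Library.Sublist"
begin

definition set_system :: "'a set \<Rightarrow> 'a set set \<Rightarrow> bool" where
  "set_system U R \<longleftrightarrow> R \<subseteq> Pow U"

definition shatters :: "'a set set \<Rightarrow> 'a set \<Rightarrow> bool" where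
  "shatters R A \<longleftrightarrow> (\<forall>B\<subseteq>A. \<exists>r\<in>R. r \<inter> A = B)"

definition vc_dim :: "'a set \<Rightarrow> 'a set set \<Rightarrow> enat" where
  "vc_dim U R = (SUP A \<in> {A. A \<subseteq> U \<and> finite A \<and> shatters R A}. enat (card A))"

definition density :: "'a set \<Rightarrow> 'a list \<Rightarrow> real" where
  "density r xs = real (card {i. i < length xs \<and> xs ! i \<in> r}) / real (length xs)"

definition eps_approximation :: "real \<Rightarrow> 'a set set \<Rightarrow> 'a list \<Rightarrow> 'a list \<Rightarrow> bool" where
  "eps_approximation \<epsilon> R X S \<longleftrightarrow>
     S \<noteq> [] \<and> subseq S X \<and> (\<forall>r\<in>R. \<bar>density r X - density r S\<bar> \<le> \<epsilon>)"

text \<open>The state of a sampler is its current sample, initially empty.  A sampler maps the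
  round number (counted from 1), the current state and the arriving element to the
  distribution of the next state.\<close>

type_synonym 'a sampler = "nat \<Rightarrow> 'a list \<Rightarrow> 'a \<Rightarrow> 'a list pmf"

text \<open>A (randomized) adversary strategy maps the elements sent so far and the current state
  of the sampler to the distribution of the next element.\<close>

type_synonym 'a adversary = "'a list \<Rightarrow> 'a list \<Rightarrow> 'a pmf"

definition adversary_on :: "'a set \<Rightarrow> 'a adversary \<Rightarrow> bool" where
  "adversary_on U adv \<longleftrightarrow> (\<forall>xs s. set_pmf (adv xs s) \<subseteq> U)"

text \<open>Joint distribution of the stream and the sampler state after the given number of rounds.\<close>

primrec adaptive_game :: "'a sampler \<Rightarrow> 'a adversary \<Rightarrow> nat \<Rightarrow> ('a list \<times> 'a list) pmf" where
  "adaptive_game smp adv 0 = return_pmf ([], [])"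
| "adaptive_game smp adv (Suc i) =
     do {
       (xs, s) \<leftarrow> adaptive_game smp adv i;
       x \<leftarrow> adv xs s;
       s' \<leftarrow> smp (Suc i) s x;
       return_pmf (xs @ [x], s')
     }"

definition robust :: "real \<Rightarrow> real \<Rightarrow> 'a set \<Rightarrow> 'a set set \<Rightarrow> nat \<Rightarrow> 'a sampler \<Rightarrow> bool" where
  "robust \<epsilon> \<delta> U R n smp \<longleftrightarrow>
     (\<forall>adv. adversary_on U adv \<longrightarrow>
        measure_pmf.prob (adaptive_game smp adv n) {(X, S). eps_approximation \<epsilon> R X S} \<ge> 1 - \<delta>)"

definition bernoulli_sample :: "real \<Rightarrow> 'a sampler" where
  "bernoulli_sample p i s x =
     do {
       b \<leftarrow> bernoulli_pmf p;
       return_pmf (if b then s @ [x] else s)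
     }"

text \<open>The stored elements are kept in order of arrival, so that the sample is literally a
  subsequence of the stream: replacing the \<open>j\<close>-th stored element by \<open>x\<close> deletes it and
  appends \<open>x\<close>.\<close>

definition reservoir_sample :: "nat \<Rightarrow> 'a sampler" where
  "reservoir_sample k i s x =
     (if i \<le> k then return_pmf (s @ [x])
      else do {
        b \<leftarrow> bernoulli_pmf (real k / real i);
        if b then do {
          j \<leftarrow> pmf_of_set {..<k};
          return_pmf (take j s @ drop (Suc j) s @ [x])
        } else return_pmf s
      })"

end

theory Submission
  imports Defs
begin

text \<open>The set system consists of the initial segments of \<open>{..<N}\<close>.  The adversary keeps every
  element it ever saw inserted into the sample below every element it saw rejected.  With \<open>lo\<close>
  the largest inserted element, \<open>r\<close> the number of insertions so far and a budget of \<open>m\<close>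
  insertions, it sends \<open>lo + (n - i) * (n + 1) ^ (m - r)\<close> after \<open>i\<close> rounds: if this is inserted, the
  next elements are larger (a further digit in base \<open>n + 1\<close>), otherwise they are smaller, since the
  digit \<open>n - i\<close> decreases.  This fits into \<open>{..<N}\<close> if \<open>(n + 1) ^ (m + 1) \<le> N\<close>.  Within the budget,
  the segment \<open>{..lo}\<close> contains the whole sample but only a small part of the stream, and by
  Markov's inequality the budget suffices with probability at least \<open>1/2\<close>.

  A reservoir makes about \<open>k * ln n\<close> insertions in total, which is too many.  So the first \<open>t = n div 4\<close>
  elements are all \<open>0\<close>, which costs only density \<open>1/4\<close> and leaves at most \<open>4 * k\<close> expected
  insertions afterwards.\<close>

text \<open>An adversary sees only the stream and the current sample, so it must recover the largest
  element ever inserted, even if it has been evicted meanwhile: the last element is inserted iff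
  it is in the sample, and the earlier inserted elements are those below the last element.\<close>

definition sampled_bound :: "nat list \<Rightarrow> nat list \<Rightarrow> nat" where
  "sampled_bound xs s = Max (insert 0 {y \<in> set xs. y \<le> last xs \<and> (y = last xs \<longrightarrow> y \<in> set s)})"

definition low_count :: "nat list \<Rightarrow> nat list \<Rightarrow> nat" where
  "low_count xs s = length (filter (\<lambda>y. y \<le> sampled_bound xs s) xs)"

definition attack :: "nat \<Rightarrow> nat \<Rightarrow> nat \<Rightarrow> nat list \<Rightarrow> nat list \<Rightarrow> nat" where
  "attack n m t xs s =
     sampled_bound xs s + (n - length xs) * (n + 1) ^ (m + t - low_count xs s)"

text \<open>\<open>adversary_on\<close> constrains every history, so the cap at \<open>N - 1\<close>
  keeps the strategy legal even after the budget is exceeded.\<close>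

definition attack_adversary :: "nat \<Rightarrow> nat \<Rightarrow> nat \<Rightarrow> nat \<Rightarrow> nat adversary" where
  "attack_adversary N n m t xs s =
     return_pmf (if length xs < t then 0 else min (attack n m t xs s) (N - 1))"

text \<open>The invariant of the attack. The factor \<open>n + 1 - length xs\<close> exceeds the
  digit of the next element by one, so that element falls inside the gap with one full unit
  \<open>(n + 1) ^ (m + t - low_count xs s)\<close> still free above it. The \<open>t\<close>
  warm-up zeros are part of \<open>low_count\<close>, hence the offsets by \<open>t\<close>.\<close>

definition separated :: "nat \<Rightarrow> nat \<Rightarrow> nat \<Rightarrow> nat list \<Rightarrow> nat list \<Rightarrow> bool" where
  "separated n m t xs s \<longleftrightarrow>
     t \<le> length xs \<and> length xs \<le> n \<and> t \<le> low_count xs s \<and> low_count xs s \<le> t + m \<and>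
     set s \<subseteq> {..sampled_bound xs s} \<and>
     (let gap = (n + 1 - length xs) * (n + 1) ^ (m + t - low_count xs s) in
        sampled_bound xs s + gap \<le> (n + 1) ^ (m + 1) \<and>
        (\<forall>y\<in>set xs. y \<le> sampled_bound xs s \<or> sampled_bound xs s + gap \<le> y))"

text \<open>Exceeding the budget is recorded as \<open>m + 1\<close> for good, whatever the adversary does next.\<close>

definition insertion_count :: "nat \<Rightarrow> nat \<Rightarrow> nat \<Rightarrow> nat list \<Rightarrow> nat list \<Rightarrow> nat" where
  "insertion_count n m t xs s = (if separated n m t xs s then low_count xs s - t else m + 1)"

section \<open>How one round of the attack changes the invariant\<close>

lemma sampled_bound_cases: "sampled_bound xs s = 0 \<or> sampled_bound xs s \<in> set xs"
proof -
  have "sampled_bound xs s \<in> insert 0 {y \<in> set xs. y \<le> last xs \<and> (y = last xs \<longrightarrow> y \<in> set s)}"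
    unfolding sampled_bound_def by (rule Max_in) auto
  then show ?thesis by auto
qed

lemma sampled_bound_accept:
  assumes "x \<in> set s"
  shows "sampled_bound (xs @ [x]) s = x"
  unfolding sampled_bound_def using assms by (intro Max_eqI) auto

text \<open>The clause on \<open>last xs\<close> excludes the rejected \<open>x\<close>, and every
  smaller element is already at most the old bound.\<close>

lemma sampled_bound_reject:
  assumes "x \<notin> set s" "sampled_bound xs r < x"
    and "\<forall>y\<in>set xs. y \<le> sampled_bound xs r \<or> x \<le> y"
  shows "sampled_bound (xs @ [x]) s = sampled_bound xs r"
  unfolding sampled_bound_def[of "xs @ [x]"]
  using assms sampled_bound_cases[of xs r] by (intro Max_eqI) force+

text \<open>The new gap is exactly \<open>x - sampled_bound xs s\<close>: the rejected element
  becomes the upper end of the gap.\<close>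

lemma separated_reject:
  assumes sep: "separated n m t xs s" and len: "length xs < n"
  defines "x \<equiv> attack n m t xs s"
  shows "separated n m t (xs @ [x]) s" "low_count (xs @ [x]) s = low_count xs s"
proof -
  let ?lo = "sampled_bound xs s"
  let ?B = "(n + 1) ^ (m + t - low_count xs s)"
  have x: "x = ?lo + (n - length xs) * ?B" by (simp add: x_def attack_def)
  have gap: "(n + 1 - length xs) * ?B = (n - length xs) * ?B + ?B"
    using len by (simp add: Suc_diff_le)
  have "?B > 0" by simp
  then have gt: "?lo < x" using len x by simp
  have far: "\<forall>y\<in>set xs. y \<le> ?lo \<or> x \<le> y"
    using sep gap unfolding separated_def Let_def x by force
  have "x \<notin> set s" using sep gt unfolding separated_def by auto
  then have lo: "sampled_bound (xs @ [x]) s = ?lo" using gt far by (rule sampled_bound_reject)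
  show cnt: "low_count (xs @ [x]) s = low_count xs s"
    using gt unfolding low_count_def lo by simp
  show "separated n m t (xs @ [x]) s"
    using sep len x gap far gt unfolding separated_def Let_def cnt lo by auto
qed

text \<open>The unit left free above \<open>x\<close> has room for \<open>n + 1\<close> units of the
  next lower power, hence for the new gap. The count is free of the budget condition because it must
  also cover the insertion that exceeds the budget.\<close>

lemma separated_accept:
  assumes sep: "separated n m t xs s" and len: "length xs < n"
  defines "x \<equiv> attack n m t xs s"
  assumes x_in: "x \<in> set s'" and s': "set s' \<subseteq> insert x (set s)"
  shows "low_count (xs @ [x]) s' = Suc (low_count xs s)"
    "low_count xs s < t + m \<Longrightarrow> separated n m t (xs @ [x]) s'"
proof -
  let ?lo = "sampled_bound xs s"
  let ?B = "(n + 1) ^ (m + t - low_count xs s)"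
  have x: "x = ?lo + (n - length xs) * ?B" by (simp add: x_def attack_def)
  have gap: "(n + 1 - length xs) * ?B = (n - length xs) * ?B + ?B"
    using len by (simp add: Suc_diff_le)
  have B0: "?B > 0" by simp
  then have gt: "?lo < x" using len x by simp
  have far: "\<forall>y\<in>set xs. y \<le> ?lo \<or> x + ?B \<le> y"
    using sep gap unfolding separated_def Let_def x by (auto simp: add.assoc)
  have lo: "sampled_bound (xs @ [x]) s' = x" using x_in by (rule sampled_bound_accept)
  have far': "y \<le> ?lo \<or> x < y" if "y \<in> set xs" for y
  proof -
    have "y \<le> ?lo \<or> x + ?B \<le> y" using far that by blast
    then show ?thesis using B0 by linarith
  qed
  have "filter (\<lambda>y. y \<le> x) xs = filter (\<lambda>y. y \<le> ?lo) xs"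
  proof (rule filter_cong[OF refl])
    show "(y \<le> x) = (y \<le> ?lo)" if "y \<in> set xs" for y
      using far'[OF that] gt by auto
  qed
  then show cnt: "low_count (xs @ [x]) s' = Suc (low_count xs s)"
    unfolding low_count_def lo by simp
  show "separated n m t (xs @ [x]) s'" if less: "low_count xs s < t + m"
  proof -
    define C where "C = (n + 1) ^ (m + t - Suc (low_count xs s))"
    have "m + t - low_count xs s = Suc (m + t - Suc (low_count xs s))" using less by simp
    then have "?B = (n + 1) * C" unfolding C_def by (simp only: power_Suc)
    then have gap': "(n + 1 - Suc (length xs)) * C \<le> ?B"
      by (simp only: mult_right_mono[OF diff_le_self zero_le])
    have top: "x + ?B \<le> (n + 1) ^ (m + 1)"
      using sep gap unfolding separated_def Let_def x by (simp add: add.assoc)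
    have "\<forall>y\<in>set xs. y \<le> x \<or> x + (n + 1 - Suc (length xs)) * C \<le> y"
      using far gap' gt by force
    moreover have "x + (n + 1 - Suc (length xs)) * C \<le> (n + 1) ^ (m + 1)"
      using top gap' by linarith
    moreover have "set s' \<subseteq> {..x}" using sep s' gt unfolding separated_def by force
    moreover have "t \<le> length xs" "t \<le> low_count xs s" using sep unfolding separated_def by auto
    ultimately show ?thesis
      using len less unfolding separated_def Let_def cnt lo by (auto simp: C_def)
  qed
qed

text \<open>The insertion that exceeds the budget raises the count from \<open>m\<close> to
  \<open>m + 1\<close>, its largest value, so even losing the invariant costs a single unit.\<close>

lemma insertion_count_step:
  assumes "length xs < n" and "separated n m t xs s \<Longrightarrow> x = attack n m t xs s"
    and "s' = s \<or> x \<in> set s' \<and> set s' \<subseteq> insert x (set s)"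
  shows "insertion_count n m t (xs @ [x]) s' \<le> insertion_count n m t xs s + (if s' = s then 0 else 1)"
proof (cases "separated n m t xs s")
  case True
  then have tm: "t \<le> low_count xs s" "low_count xs s \<le> t + m" and x: "x = attack n m t xs s"
    using assms(2) unfolding separated_def by auto
  show ?thesis
  proof (cases "s' = s")
    case True
    with \<open>separated n m t xs s\<close> show ?thesis
      using separated_reject[of n m t xs s] assms(1) x by (simp add: insertion_count_def)
  next
    case False
    then have "x \<in> set s'" "set s' \<subseteq> insert x (set s)" using assms(3) by auto
    note accept = separated_accept[OF \<open>separated n m t xs s\<close> assms(1), of s', folded x, OF this]
    have "insertion_count n m t (xs @ [x]) s' \<le> Suc (low_count xs s) - t"
    proof (cases "low_count xs s < t + m")
      case True
      then show ?thesis using accept by (simp add: insertion_count_def)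
    next
      case False
      then show ?thesis using accept tm by (simp add: insertion_count_def)
    qed
    then show ?thesis
      using \<open>separated n m t xs s\<close> False tm by (simp add: insertion_count_def)
  qed
next
  case False
  then show ?thesis by (auto simp: insertion_count_def separated_def)
qed

section \<open>The expected number of insertions during the game\<close>

lemma attack_less:
  assumes "separated n m t xs s" "length xs < n"
  shows "attack n m t xs s < (n + 1) ^ (m + 1)"
proof -
  have "(n + 1 - length xs) * (n + 1) ^ (m + t - low_count xs s)
      = (n - length xs) * (n + 1) ^ (m + t - low_count xs s) + (n + 1) ^ (m + t - low_count xs s)"
    using assms(2) by (simp add: Suc_diff_le)
  moreover have "(n + 1) ^ (m + t - low_count xs s) > 0" by simp
  ultimately show ?thesis using assms(1) unfolding separated_def Let_def attack_def by linarith
qed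

text \<open>What the attack uses of both samplers: a changed sample contains the new element, and a
  discarded element never returns unless it is sent again.\<close>

definition inserting_sampler :: "'a sampler \<Rightarrow> bool" where
  "inserting_sampler smp \<longleftrightarrow>
     (\<forall>i s x. \<forall>s'\<in>set_pmf (smp i s x). s' = s \<or> x \<in> set s' \<and> set s' \<subseteq> insert x (set s))"

lemma adaptive_game_length:
  "(xs, s) \<in> set_pmf (adaptive_game smp adv i) \<Longrightarrow> length xs = i"
  by (induction i arbitrary: xs s) auto

lemma adaptive_game_warm_up:
  assumes smp: "inserting_sampler smp"
  shows "i \<le> t \<Longrightarrow> (xs, s) \<in> set_pmf (adaptive_game smp (attack_adversary N n m t) i) \<Longrightarrow>
    set xs \<subseteq> {0} \<and> set s \<subseteq> {0}"
proof (induction i arbitrary: xs s)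
  case (Suc i)
  let ?A = "attack_adversary N n m t"
  obtain ys r x where ys: "(ys, r) \<in> set_pmf (adaptive_game smp ?A i)"
    and x: "x \<in> set_pmf (?A ys r)" and xs: "xs = ys @ [x]" and s: "s \<in> set_pmf (smp (Suc i) r x)"
    using Suc.prems(2) by auto
  have "x = 0" using x adaptive_game_length[OF ys] Suc.prems(1) by (simp add: attack_adversary_def)
  have "set ys \<subseteq> {0} \<and> set r \<subseteq> {0}" using Suc.IH[OF _ ys] Suc.prems by simp
  moreover have "s = r \<or> set s \<subseteq> insert x (set r)" using smp s unfolding inserting_sampler_def by blast
  ultimately show ?case using xs \<open>x = 0\<close> by auto
qed simp

text \<open>Whatever the sampler did with the zeros, the recovered bound is \<open>0\<close> and all
  \<open>t\<close> of them count as low.\<close>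

lemma insertion_count_warm_up:
  assumes "t \<le> n" "length xs = t" "set xs \<subseteq> {0}" "set s \<subseteq> {0}"
  shows "insertion_count n m t xs s = 0"
proof -
  have lo: "sampled_bound xs s = 0" using assms sampled_bound_cases[of xs s] by auto
  have "filter (\<lambda>y. y \<le> 0) xs = xs" using assms by (auto simp: filter_id_conv)
  then have cnt: "low_count xs s = t" unfolding low_count_def lo using assms by simp
  have "(n + 1 - t) * (n + 1) ^ m \<le> (n + 1) ^ (m + 1)" by (simp del: mult_Suc)
  then have "separated n m t xs s"
    unfolding separated_def Let_def lo cnt using assms by auto
  then show ?thesis by (simp add: insertion_count_def cnt)
qed

text \<open>Given any history, the state changes in the next round with probability at most
  \<open>q i\<close>, so by \<open>insertion_count_step\<close> the expected count grows by at most
  \<open>q i\<close>.\<close>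

lemma expected_insertion_count:
  fixes q :: "nat \<Rightarrow> real"
  assumes smp: "inserting_sampler smp"
    and q: "\<And>i s x. t \<le> i \<Longrightarrow> i < n \<Longrightarrow> measure_pmf.prob (smp (Suc i) s x) {s'. s' \<noteq> s} \<le> q i"
    and N: "(n + 1) ^ (m + 1) \<le> N"
  shows "t \<le> i \<Longrightarrow> i \<le> n \<Longrightarrow>
    (\<integral>\<^sup>+ z. of_nat (insertion_count n m t (fst z) (snd z))
       \<partial>measure_pmf (adaptive_game smp (attack_adversary N n m t) i)) \<le> ennreal (\<Sum>j=t..<i. q j)"
proof (induction i rule: dec_induct)
  case base
  let ?G = "adaptive_game smp (attack_adversary N n m t) t"
  have "(\<integral>\<^sup>+ z. of_nat (insertion_count n m t (fst z) (snd z)) \<partial>measure_pmf ?G)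
      = (\<integral>\<^sup>+ z. 0 \<partial>measure_pmf ?G)"
  proof (rule nn_integral_cong_AE, rule AE_pmfI)
    fix z assume "z \<in> set_pmf ?G"
    then have "(fst z, snd z) \<in> set_pmf ?G" by simp
    from adaptive_game_length[OF this] adaptive_game_warm_up[OF smp order.refl this] base
    show "of_nat (insertion_count n m t (fst z) (snd z)) = (0 :: ennreal)"
      using insertion_count_warm_up by simp
  qed
  then show ?case by simp
next
  case (step i)
  let ?A = "attack_adversary N n m t"
  let ?G = "adaptive_game smp ?A i"
  let ?F = "\<lambda>xs s. of_nat (insertion_count n m t xs s) :: ennreal"
  let ?x = "\<lambda>xs s. min (attack n m t xs s) (N - 1)"
  have q0: "q j \<ge> 0" if "t \<le> j" "j < n" for j
    using q[OF that] measure_nonneg order_trans by blast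
  have round: "(\<integral>\<^sup>+ x. \<integral>\<^sup>+ s'. ?F (xs @ [x]) s' \<partial>measure_pmf (smp (Suc i) s x) \<partial>measure_pmf (?A xs s))
      \<le> ?F xs s + ennreal (q i)" if "(xs, s) \<in> set_pmf ?G" for xs s
  proof -
    have len: "length xs = i" using adaptive_game_length that by blast
    let ?S = "smp (Suc i) s (?x xs s)"
    have "(\<integral>\<^sup>+ x. \<integral>\<^sup>+ s'. ?F (xs @ [x]) s' \<partial>measure_pmf (smp (Suc i) s x) \<partial>measure_pmf (?A xs s))
        = (\<integral>\<^sup>+ s'. ?F (xs @ [?x xs s]) s' \<partial>measure_pmf ?S)"
      using len step by (simp add: attack_adversary_def)
    also have "\<dots> \<le> (\<integral>\<^sup>+ s'. ?F xs s + indicator {s'. s' \<noteq> s} s' \<partial>measure_pmf ?S)"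
    proof (rule nn_integral_mono_AE, rule AE_pmfI)
      fix s' assume "s' \<in> set_pmf ?S"
      then have "s' = s \<or> ?x xs s \<in> set s' \<and> set s' \<subseteq> insert (?x xs s) (set s)"
        using smp unfolding inserting_sampler_def by blast
      \<comment> \<open>Under the invariant the attack stays below \<open>N\<close>, so the cap does
        not alter it.\<close>
      moreover have "?x xs s = attack n m t xs s" if "separated n m t xs s"
        using attack_less[OF that] len step N by simp
      ultimately have "insertion_count n m t (xs @ [?x xs s]) s'
          \<le> insertion_count n m t xs s + (if s' = s then 0 else 1)"
        using len step by (intro insertion_count_step) auto
      then have "?F (xs @ [?x xs s]) s' \<le> of_nat (insertion_count n m t xs s + (if s' = s then 0 else 1))"
        by (simp only: of_nat_le_iff)
      then show "?F (xs @ [?x xs s]) s' \<le> ?F xs s + indicator {s'. s' \<noteq> s} s'"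
        by (auto simp: indicator_def split: if_splits)
    qed
    also have "\<dots> = ?F xs s + emeasure (measure_pmf ?S) {s'. s' \<noteq> s}"
      by (simp add: nn_integral_add)
    also have "\<dots> \<le> ?F xs s + ennreal (q i)"
      using q[of i s "?x xs s"] step
      by (intro add_left_mono) (simp add: measure_pmf.emeasure_eq_measure ennreal_leI)
    finally show ?thesis .
  qed
  have "(\<integral>\<^sup>+ z. ?F (fst z) (snd z) \<partial>measure_pmf (adaptive_game smp ?A (Suc i)))
      = (\<integral>\<^sup>+ z. (\<integral>\<^sup>+ x. \<integral>\<^sup>+ s'. ?F (fst z @ [x]) s' \<partial>measure_pmf (smp (Suc i) (snd z) x)
            \<partial>measure_pmf (?A (fst z) (snd z))) \<partial>measure_pmf ?G)"
    by (simp add: nn_integral_bind_pmf split_beta)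
  also have "\<dots> \<le> (\<integral>\<^sup>+ z. ?F (fst z) (snd z) + ennreal (q i) \<partial>measure_pmf ?G)"
    by (intro nn_integral_mono_AE AE_pmfI round) simp
  also have "\<dots> = (\<integral>\<^sup>+ z. ?F (fst z) (snd z) \<partial>measure_pmf ?G) + ennreal (q i)"
    by (simp add: nn_integral_add)
  also have "\<dots> \<le> ennreal (\<Sum>j=t..<i. q j) + ennreal (q i)"
    using step by (intro add_right_mono) simp
  also have "\<dots> = ennreal (\<Sum>j=t..<Suc i. q j)"
    using step q0 by (subst ennreal_plus[symmetric]) (auto intro!: sum_nonneg)
  finally show ?case .
qed

section \<open>From few insertions to failure of robustness\<close>

lemma separated_not_eps_approximation:
  assumes sep: "separated n m t xs s" and len: "length xs = n" and "n > 0"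
    and half: "2 * (t + m) \<le> n" and N: "(n + 1) ^ (m + 1) \<le> N" and eps: "\<epsilon> < 1 / 2"
  shows "\<not> eps_approximation \<epsilon> ((\<lambda>b. {..b}) ` {..<N}) xs s"
proof
  assume approx: "eps_approximation \<epsilon> ((\<lambda>b. {..b}) ` {..<N}) xs s"
  let ?lo = "sampled_bound xs s"
  \<comment> \<open>The gap is positive, so the bound is below \<open>N\<close> and its segment
    belongs to the system.\<close>
  have "0 < (n + 1) ^ (m + t - low_count xs s)" by simp
  moreover have "?lo + (n + 1 - n) * (n + 1) ^ (m + t - low_count xs s) \<le> (n + 1) ^ (m + 1)"
    using sep unfolding separated_def Let_def len by blast
  then have "?lo + (n + 1) ^ (m + t - low_count xs s) \<le> (n + 1) ^ (m + 1)"
    by (simp only: diff_add_inverse mult_1)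
  ultimately have "?lo < N" using N by linarith
  then have "\<bar>density {..?lo} xs - density {..?lo} s\<bar> \<le> \<epsilon>"
    using approx unfolding eps_approximation_def by blast
  moreover have "density {..?lo} s = 1"
  proof -
    \<comment> \<open>For density \<open>1\<close> the sample must also be non-empty, which
      \<open>approx\<close> supplies; for an empty sample the quotient is
      \<open>0 / 0 = 0\<close>.\<close>
    have "{i. i < length s \<and> s ! i \<in> {..?lo}} = {..<length s}"
      using sep unfolding separated_def by (auto dest: nth_mem)
    then show ?thesis using approx by (simp add: density_def eps_approximation_def)
  qed
  moreover have "density {..?lo} xs \<le> 1 / 2"
  proof -
    have "density {..?lo} xs = real (low_count xs s) / real n"
      unfolding density_def low_count_def length_filter_conv_card len by simp
    also have "\<dots> \<le> real (t + m) / real n"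
      using sep unfolding separated_def by (intro divide_right_mono of_nat_mono) auto
    also have "\<dots> \<le> 1 / 2" using half \<open>n > 0\<close> by (simp add: field_simps)
    finally show ?thesis .
  qed
  ultimately show False using eps by linarith
qed

text \<open>Markov's inequality: a good outcome forces the count \<open>m + 1\<close>, while the
  expected count is at most half of that.\<close>

lemma attack_not_robust:
  fixes q :: "nat \<Rightarrow> real"
  assumes smp: "inserting_sampler smp"
    and q: "\<And>i s x. t \<le> i \<Longrightarrow> i < n \<Longrightarrow> measure_pmf.prob (smp (Suc i) s x) {s'. s' \<noteq> s} \<le> q i"
    and sum_q: "2 * (\<Sum>i=t..<n. q i) \<le> real (m + 1)"
    and "n > 0" and half: "2 * (t + m) \<le> n" and N: "(n + 1) ^ (m + 1) \<le> N"
    and "\<epsilon> < 1 / 2" "\<delta> < 1 / 2"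
  shows "\<not> robust \<epsilon> \<delta> {..<N} ((\<lambda>b. {..b}) ` {..<N}) n smp"
proof
  let ?R = "(\<lambda>b. {..b}) ` {..<N}" and ?A = "attack_adversary N n m t"
  let ?G = "adaptive_game smp ?A n"
  let ?F = "\<lambda>z. of_nat (insertion_count n m t (fst z) (snd z)) :: ennreal"
  let ?good = "{(X, S). eps_approximation \<epsilon> ?R X S}"
  assume rob: "robust \<epsilon> \<delta> {..<N} ?R n smp"
  have "0 < (n + 1) ^ (m + 1)" by simp
  then have "0 < N" using N by linarith
  then have "adversary_on {..<N} ?A"
    by (auto simp: adversary_on_def attack_adversary_def)
  then have "measure_pmf.prob ?G ?good \<ge> 1 - \<delta>" using rob unfolding robust_def by blast
  then have large: "measure_pmf.prob ?G ?good > 1 / 2" using \<open>\<delta> < 1 / 2\<close> by linarith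
  have "of_nat (m + 1) * emeasure (measure_pmf ?G) ?good
      = (\<integral>\<^sup>+ z. of_nat (m + 1) * indicator ?good z \<partial>measure_pmf ?G)"
    by (simp add: nn_integral_cmult)
  also have "\<dots> \<le> (\<integral>\<^sup>+ z. ?F z \<partial>measure_pmf ?G)"
  proof (rule nn_integral_mono_AE, rule AE_pmfI)
    fix z assume "z \<in> set_pmf ?G"
    then have len: "length (fst z) = n" using adaptive_game_length[of "fst z" "snd z"] by simp
    show "of_nat (m + 1) * indicator ?good z \<le> ?F z"
    proof (cases "separated n m t (fst z) (snd z)")
      case True
      then have "z \<notin> ?good"
        using separated_not_eps_approximation[OF True len \<open>n > 0\<close> half N \<open>\<epsilon> < 1 / 2\<close>] by auto
      then show ?thesis by simp
    next
      case False
      then show ?thesis by (simp add: insertion_count_def indicator_def)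
    qed
  qed
  also have "\<dots> \<le> ennreal (\<Sum>i=t..<n. q i)"
    using half by (intro expected_insertion_count smp q N) auto
  finally have "ennreal (real (m + 1) * measure_pmf.prob ?G ?good) \<le> ennreal (\<Sum>i=t..<n. q i)"
    by (simp add: measure_pmf.emeasure_eq_measure ennreal_mult ennreal_of_nat_eq_real_of_nat)
  \<comment> \<open>Negative reals collapse to \<open>0\<close> in \<open>ennreal\<close>, so
    positivity is needed to return to the reals.\<close>
  moreover have pos: "0 < real (m + 1) * measure_pmf.prob ?G ?good" using large by simp
  ultimately have "real (m + 1) * measure_pmf.prob ?G ?good \<le> (\<Sum>i=t..<n. q i)"
    using ennreal_le_iff2 by (metis not_le)
  moreover have "real (m + 1) * (1 / 2) < real (m + 1) * measure_pmf.prob ?G ?good"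
    using large by (intro mult_strict_left_mono) auto
  ultimately have "real (m + 1) * (1 / 2) < (\<Sum>i=t..<n. q i)" by (rule less_le_trans[rotated])
  then show False using sum_q by simp
qed

section \<open>Change probabilities of the two samplers\<close>

lemma inserting_sampler_bernoulli: "inserting_sampler (bernoulli_sample p)"
  unfolding inserting_sampler_def bernoulli_sample_def by auto

lemma bernoulli_sample_change:
  assumes "0 \<le> p" "p \<le> 1"
  shows "measure_pmf.prob (bernoulli_sample p i s x) {s'. s' \<noteq> s} \<le> p"
proof -
  have "bernoulli_sample p i s x = map_pmf (\<lambda>b. if b then s @ [x] else s) (bernoulli_pmf p)"
    by (simp add: bernoulli_sample_def map_pmf_def)
  moreover have "(\<lambda>b. if b then s @ [x] else s) -` {s'. s' \<noteq> s} = {True}" by auto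
  ultimately show ?thesis using assms by (simp add: measure_pmf_single)
qed

lemma inserting_sampler_reservoir: "inserting_sampler (reservoir_sample k)"
  unfolding inserting_sampler_def
proof (intro allI ballI)
  fix i s s' and x :: 'a
  assume s': "s' \<in> set_pmf (reservoir_sample k i s x)"
  \<comment> \<open>Holding for every \<open>j\<close>, this also covers \<open>k = 0\<close>, where
    \<open>{..<k}\<close> is empty.\<close>
  have "set (take j s @ drop (Suc j) s @ [x]) \<subseteq> insert x (set s)" for j
    using set_take_subset[of j s] set_drop_subset[of "Suc j" s] by auto
  then show "s' = s \<or> x \<in> set s' \<and> set s' \<subseteq> insert x (set s)"
    using s' by (fastforce simp: reservoir_sample_def split: if_splits)
qed

text \<open>Only the outcome \<open>True\<close> of the coin can change the sample; the eviction
  that follows is bounded by probability one.\<close>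

lemma reservoir_sample_change:
  assumes "k < i"
  shows "measure_pmf.prob (reservoir_sample k i s x) {s'. s' \<noteq> s} \<le> real k / real i"
proof -
  let ?p = "real k / real i"
  let ?K = "\<lambda>b. if b then pmf_of_set {..<k} \<bind> (\<lambda>j. return_pmf (take j s @ drop (Suc j) s @ [x]))
    else return_pmf s"
  have p: "0 \<le> ?p" "?p \<le> 1" using assms by auto
  have "emeasure (measure_pmf (reservoir_sample k i s x)) {s'. s' \<noteq> s}
      = (\<integral>\<^sup>+ b. emeasure (measure_pmf (?K b)) {s'. s' \<noteq> s} \<partial>measure_pmf (bernoulli_pmf ?p))"
    using assms by (simp add: reservoir_sample_def)
  also have "\<dots> \<le> (\<integral>\<^sup>+ b. indicator {True} b \<partial>measure_pmf (bernoulli_pmf ?p))"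
    by (intro nn_integral_mono)
       (auto simp: indicator_def measure_pmf.emeasure_eq_measure intro!: measure_pmf.prob_le_1)
  also have "\<dots> = ennreal ?p" using p by (simp add: emeasure_pmf_single)
  finally show ?thesis using p by (simp add: measure_pmf.emeasure_eq_measure)
qed

section \<open>VC-dimension of the initial segments\<close>

lemma vc_dim_prefixes:
  fixes N :: nat
  assumes "N \<ge> 2"
  shows "vc_dim {..<N} ((\<lambda>b. {..b}) ` {..<N}) = 1"
proof (rule antisym)
  let ?R = "(\<lambda>b. {..b}) ` {..<N}"
  show "vc_dim {..<N} ?R \<le> 1"
    unfolding vc_dim_def
  proof (rule SUP_least)
    fix A assume "A \<in> {A. A \<subseteq> {..<N} \<and> finite A \<and> shatters ?R A}"
    then have fin: "finite A" and sh: "shatters ?R A" by auto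
    \<comment> \<open>A segment containing \<open>b\<close> contains every smaller \<open>a\<close>,
      so it cannot cut out \<open>{b}\<close> alone.\<close>
    have eq: "a = b" if ab: "a \<in> A" "b \<in> A" "a \<le> b" for a b
    proof -
      have "{b} \<subseteq> A" using ab by simp
      then obtain c where c: "{..c} \<inter> A = {b}" using sh unfolding shatters_def by blast
      then have "b \<in> {..c}" by blast
      then have "a \<in> {..c} \<inter> A" using ab by simp
      then show ?thesis unfolding c by simp
    qed
    have "a = b" if "a \<in> A" "b \<in> A" for a b using eq[of a b] eq[of b a] that by linarith
    then have "card A \<le> Suc 0" using card_le_Suc0_iff_eq[OF fin] by blast
    then show "enat (card A) \<le> 1" by (simp add: one_enat_def)
  qed
  \<comment> \<open>The point \<open>0\<close> would not do, since it lies in every segment.\<close>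
  have "shatters ?R {1}"
    unfolding shatters_def
  proof (intro allI impI)
    fix B :: "nat set" assume "B \<subseteq> {1}"
    then consider "B = {}" | "B = {1}" by auto
    then show "\<exists>r\<in>?R. r \<inter> {1} = B"
    proof cases
      case 1
      then show ?thesis using assms by (intro bexI[of _ "{..0}"] image_eqI[of _ _ 0]) auto
    next
      case 2
      then show ?thesis using assms by (intro bexI[of _ "{..1}"] image_eqI[of _ _ 1]) auto
    qed
  qed
  then have "enat (card {1 :: nat}) \<le> vc_dim {..<N} ?R"
    unfolding vc_dim_def using assms by (intro SUP_upper[of "{1}" _ "\<lambda>A. enat (card A)"]) simp
  then show "1 \<le> vc_dim {..<N} ?R" by (simp add: one_enat_def)
qed

section \<open>Choice of the insertion budget\<close>

lemma powr_ln_ge_square: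
  fixes n :: nat
  assumes "n \<ge> 2"
  shows "real n ^ 2 \<le> real n powr (6 * ln (real n))"
proof -
  have "ln 2 \<ge> (1 / 2 :: real)" using ln2_ge_two_thirds by simp
  then have "2 \<le> 6 * ln (real n)" using assms ln_le_cancel_iff[of 2 "real n"] by linarith
  then have "real n powr 2 \<le> real n powr (6 * ln (real n))" using assms by (intro powr_mono) auto
  then show ?thesis using assms by (simp add: powr_numeral)
qed

text \<open>The budget is the greatest \<open>m\<close> with \<open>(n + 1) ^ (m + 1) <= N\<close>:
  the upper bound on \<open>N\<close> limits it, and maximality makes it at least of order
  \<open>ln N / ln n\<close>.\<close>

lemma budget_exists:
  fixes n N :: nat
  assumes n: "n \<ge> 2" and lower: "real n powr (6 * ln (real n)) \<le> real N"
    and upper: "real N \<le> 2 powr (real n / 2)"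
  obtains m where "(n + 1) ^ (m + 1) \<le> N" "4 * (m + 1) \<le> n" "ln (real N) / ln (real n) \<le> 4 * real (m + 1)"
proof -
  have "real n ^ 2 \<le> real N" using powr_ln_ge_square[OF n] lower by linarith
  then have n2N: "n ^ 2 \<le> N" by (metis of_nat_le_iff of_nat_power)
  have n_sq: "n + 1 \<le> n ^ 2"
  proof -
    have "n + 1 \<le> 2 * n" using n by simp
    also have "\<dots> \<le> n * n" using n by (intro mult_right_mono) auto
    finally show ?thesis by (simp add: power2_eq_square)
  qed
  have n3: "n \<ge> 3"
  proof (rule ccontr)
    assume "\<not> n \<ge> 3"
    \<comment> \<open>For \<open>n = 2\<close> the bounds \<open>4 <= N\<close> and
      \<open>N <= 2\<close> clash. From \<open>n = 3\<close> on, \<open>4 <= n + 1\<close>, as the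
      comparison with powers of \<open>4\<close> requires.\<close>
    then have "n = 2" using n by simp
    then show False using upper n2N by simp
  qed
  define P where "P j \<longleftrightarrow> (n + 1) ^ (j + 1) \<le> N" for j
  have P0: "P 0" using n_sq n2N by (simp add: P_def)
  have bound: "4 * (j + 1) \<le> n" if "P j" for j
  proof -
    have "(2 :: real) powr (2 * (real j + 1)) = 4 ^ (j + 1)"
      by (simp add: powr_powr[symmetric] powr_realpow powr_add)
    also have "\<dots> \<le> real (n + 1) ^ (j + 1)" using n3 by (intro power_mono) auto
    also have "\<dots> \<le> real N" using that unfolding P_def by (metis of_nat_le_iff of_nat_power)
    also have "\<dots> \<le> 2 powr (real n / 2)" by (rule upper)
    finally have "2 * (real j + 1) \<le> real n / 2" by simp
    then show ?thesis by simp
  qed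
  define m where "m = (GREATEST j. P j)"
  have "\<And>j. P j \<Longrightarrow> j \<le> n" using bound by force
  then have Pm: "P m" and max: "\<And>j. P j \<Longrightarrow> j \<le> m"
    unfolding m_def using P0 by (blast intro: GreatestI_nat Greatest_le_nat)+
  have "\<not> P (Suc m)" using max[of "Suc m"] by auto
  then have "N < (n + 1) ^ (m + 2)" by (simp add: P_def)
  also have "\<dots> \<le> (n ^ 2) ^ (m + 2)" using n_sq by (rule power_mono) simp
  also have "\<dots> = n ^ (2 * (m + 2))" by (simp only: power_mult)
  finally have "real N < real n ^ (2 * (m + 2))" by (metis of_nat_less_iff of_nat_power)
  moreover have Npos: "real N > 0" using n2N n by (auto intro: Nat.gr0I)
  ultimately have "ln (real N) \<le> ln (real n ^ (2 * (m + 2)))" by simp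
  also have "\<dots> = real (2 * (m + 2)) * ln (real n)" by (rule ln_realpow)
  \<comment> \<open>\<open>2 * (m + 2) <= 4 * (m + 1)\<close> holds already at
    \<open>m = 0\<close>.\<close>
  also have "\<dots> \<le> 4 * real (m + 1) * ln (real n)" using n by (intro mult_right_mono) auto
  finally have "ln (real N) / ln (real n) \<le> 4 * real (m + 1)" using n by (simp add: field_simps)
  with Pm bound[OF Pm] show ?thesis using that unfolding P_def by blast
qed

theorem theorem1p2:
  "\<exists>c::real. c > 0 \<and>
    (\<forall>(n::nat) (N::nat).
       n \<ge> 2 \<longrightarrow> real n powr (6 * ln (real n)) \<le> real N \<longrightarrow> real N \<le> 2 powr (real n / 2) \<longrightarrow>
       (\<exists>(U::nat set) (R::nat set set).
          set_system U R \<and> finite U \<and> card U = N \<and> finite R \<and> card R = N \<and> vc_dim U R = 1 \<and>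
          (\<forall>(\<epsilon>::real) (\<delta>::real). 0 < \<epsilon> \<longrightarrow> \<epsilon> < 1/2 \<longrightarrow> 0 < \<delta> \<longrightarrow> \<delta> < 1/2 \<longrightarrow>
             (\<forall>p::real. 0 \<le> p \<longrightarrow> p \<le> 1 \<longrightarrow>
                p < c * (ln (real (card R)) / (real n * ln (real n))) \<longrightarrow>
                \<not> robust \<epsilon> \<delta> U R n (bernoulli_sample p)) \<and>
             (\<forall>k::nat. real k < c * (ln (real (card R)) / ln (real n)) \<longrightarrow>
                \<not> robust \<epsilon> \<delta> U R n (reservoir_sample k)))))"
proof (intro exI[of _ "1 / 32"] conjI allI impI)
  fix n N :: nat
  assume n: "n \<ge> 2" and lower: "real n powr (6 * ln (real n)) \<le> real N"
    and upper: "real N \<le> 2 powr (real n / 2)"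
  obtain m where m: "(n + 1) ^ (m + 1) \<le> N" "4 * (m + 1) \<le> n"
    "ln (real N) / ln (real n) \<le> 4 * real (m + 1)"
    using budget_exists[OF n lower upper] .
  define R where "R = (\<lambda>b::nat. {..b}) ` {..<N}"
  have "(n + 1) ^ 1 \<le> (n + 1) ^ (m + 1)" by (intro power_increasing) auto
  then have N2: "N \<ge> 2" using m n by simp
  have card_R: "card R = N" unfolding R_def by (subst card_image) (auto simp: inj_on_def)
  have bernoulli: "\<not> robust \<epsilon> \<delta> {..<N} R n (bernoulli_sample p)"
    if "\<epsilon> < 1 / 2" "\<delta> < 1 / 2" "0 \<le> p" "p \<le> 1"
      "p < 1 / 32 * (ln (real N) / (real n * ln (real n)))" for \<epsilon> \<delta> p
    unfolding R_def
  proof (rule attack_not_robust[where t = 0 and m = m and q = "\<lambda>_. p"])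
    have "ln (real N) / (real n * ln (real n)) = ln (real N) / ln (real n) / real n" by simp
    also have "\<dots> \<le> 4 * real (m + 1) / real n" using m(3) by (intro divide_right_mono) auto
    finally have "1 / 32 * (ln (real N) / (real n * ln (real n))) \<le> 1 / 32 * (4 * real (m + 1) / real n)"
      by (rule mult_left_mono) simp
    with that(5) have "p < 1 / 32 * (4 * real (m + 1) / real n)" by (rule less_le_trans)
    then show "2 * (\<Sum>i=0..<n. p) \<le> real (m + 1)" using n by (simp add: field_simps)
  qed (use that m n in \<open>auto intro: inserting_sampler_bernoulli bernoulli_sample_change\<close>)
  \<comment> \<open>The constant \<open>1 / 32\<close> comes from here: \<open>4\<close> from the
    size of the budget, \<open>4\<close> from the warm-up and \<open>2\<close> from Markov's
    inequality.\<close>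
  have reservoir: "\<not> robust \<epsilon> \<delta> {..<N} R n (reservoir_sample k)"
    if "\<epsilon> < 1 / 2" "\<delta> < 1 / 2" "real k < 1 / 32 * (ln (real N) / ln (real n))" for \<epsilon> \<delta> k
    unfolding R_def
  proof (rule attack_not_robust[where t = "n div 4" and m = m and q = "\<lambda>i. real k / real (Suc i)"])
    have "1 / 32 * (ln (real N) / ln (real n)) \<le> 1 / 32 * (4 * real (m + 1))"
      using m(3) by (rule mult_left_mono) simp
    with that(3) have "real k < 1 / 32 * (4 * real (m + 1))" by (rule less_le_trans)
    then have k: "8 * real k \<le> real (m + 1)" by simp
    \<comment> \<open>The reservoir is full when the warm-up ends, so each later round changes it
      with probability at most \<open>k / Suc i\<close>.\<close>
    then have "8 * k \<le> m + 1" by linarith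
    also have "m + 1 \<le> 4 * (m + 1)" by simp
    also have "\<dots> \<le> n" by (rule m(2))
    finally have "4 * k \<le> n" by linarith
    then have k_le: "k \<le> n div 4" by (simp add: less_eq_div_iff_mult_less_eq)
    show "measure_pmf.prob (reservoir_sample k (Suc i) s x) {s'. s' \<noteq> s} \<le> real k / real (Suc i)"
      if "n div 4 \<le> i" for i s and x :: nat
      using order.trans[OF k_le that] by (intro reservoir_sample_change) (rule le_imp_less_Suc)
    have "(\<Sum>i=n div 4..<n. real k / real (Suc i)) \<le> (\<Sum>i=n div 4..<n. 4 * real k / real n)"
    proof (rule sum_mono)
      fix i assume "i \<in> {n div 4..<n}"
      then have "n div 4 \<le> i" by simp
      then have "4 * (n div 4) \<le> 4 * i" by simp
      \<comment> \<open>The round number is \<open>Suc i\<close>, and this extra one absorbs the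
        rounding in \<open>n div 4\<close>.\<close>
      moreover have "n < 4 + 4 * (n div 4)" by (rule dividend_less_times_div) simp
      ultimately have "n \<le> 4 * Suc i" by simp
      then have "real n \<le> 4 * real (Suc i)" by linarith
      then have "real k * real n \<le> real k * (4 * real (Suc i))" by (intro mult_left_mono) auto
      then show "real k / real (Suc i) \<le> 4 * real k / real n"
        using n by (simp add: divide_le_eq le_divide_eq mult_ac)
    qed
    also have "\<dots> = real (n - n div 4) * (4 * real k / real n)" by simp
    also have "\<dots> \<le> real n * (4 * real k / real n)" by (intro mult_right_mono) auto
    also have "\<dots> = 4 * real k" using n by simp
    finally show "2 * (\<Sum>i=n div 4..<n. real k / real (Suc i)) \<le> real (m + 1)" using k by linarith
  qed (use that m n in \<open>auto intro: inserting_sampler_reservoir\<close>)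
  show "\<exists>(U::nat set) (R::nat set set).
          set_system U R \<and> finite U \<and> card U = N \<and> finite R \<and> card R = N \<and> vc_dim U R = 1 \<and>
          (\<forall>(\<epsilon>::real) (\<delta>::real). 0 < \<epsilon> \<longrightarrow> \<epsilon> < 1/2 \<longrightarrow> 0 < \<delta> \<longrightarrow> \<delta> < 1/2 \<longrightarrow>
             (\<forall>p::real. 0 \<le> p \<longrightarrow> p \<le> 1 \<longrightarrow>
                p < 1 / 32 * (ln (real (card R)) / (real n * ln (real n))) \<longrightarrow>
                \<not> robust \<epsilon> \<delta> U R n (bernoulli_sample p)) \<and>
             (\<forall>k::nat. real k < 1 / 32 * (ln (real (card R)) / ln (real n)) \<longrightarrow>
                \<not> robust \<epsilon> \<delta> U R n (reservoir_sample k)))"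
  proof (intro exI[of _ "{..<N}"] exI[of _ R] conjI)
    show "set_system {..<N} R" by (auto simp: set_system_def R_def)
    show "vc_dim {..<N} R = 1" unfolding R_def using N2 by (rule vc_dim_prefixes)
  qed (use bernoulli reservoir card_R in \<open>auto simp: R_def\<close>)
qed simp

end
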